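(* Let $\Sigma=(\mathbb{R}^{n},U,\mathcal{U},f)$ be a control system and let $\varepsilon>0$ be any desired precision. Suppose that $\Sigma$ is incrementally globally asymptotically stable ($\delta$-GAS), and let $\beta$ be a $\mathcal{KL}$ function as in the definition of $\delta$-GAS, i.e. $\|\mathbf{x}(t,x,\mathbf{u})-\mathbf{x}(t,y,\mathbf{u})\|\le\beta(\|x-y\|,t)$ for all $t\ge 0$, all $x,y\in\mathbb{R}^n$ and all $\mathbf{u}\in\mathcal{U}$. Then for any $\tau>0$, $\eta>0$ and $\mu>0$ satisfying $$\beta(\varepsilon,\tau)+\mu+\eta/2\le\varepsilon,$$ the transition system $T_{\tau}(\Sigma)$ is $\varepsilon$-bisimilar to the transition system $T_{\tau,\eta,\mu}(\Sigma)$.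
   Context: **Notation.** $\|\cdot\|$ is the infinity norm on $\mathbb{R}^n$. For $A\subseteq\mathbb{R}^n$ and $\mu>0$, $[A]_\mu:=\{a\in A : a_i=k_i\mu,\ k_i\in\mathbb{Z},\ i=1,\dots,n\}$. A continuous function $\gamma:[0,\infty)\to[0,\infty)$ is of class $\mathcal{K}$ if it is strictly increasing with $\gamma(0)=0$, and of class $\mathcal{K}_\infty$ if moreover $\gamma(r)\to\infty$ as $r\to\infty$. A continuous function $\beta:[0,\infty)\times[0,\infty)\to[0,\infty)$ is of class $\mathcal{KL}$ if for each fixed $s$ the map $r\mapsto\beta(r,s)$ is of class $\mathcal{K}_\infty$, and for each fixed $r$ the map $s\mapsto\beta(r,s)$ is decreasing with $\beta(r,s)\to0$ as $s\to\infty$. For a relation $R\subseteq A\times B$, $R(A)=\{b\in B:\exists a\in A,\ (a,b)\in R\}$ and $R^{-1}(B)=\{a\in A:\exists b\in B,\ (a,b)\in R\}$. **Control systems.** A control system is a quadruple $\Sigma=(\mathbb{R}^n,U,\mathcal{U},f)$ where $U\subseteq\mathbb{R}^m$ is the input space; $\mathcal{U}$ is a subset of the set of all locally essentially bounded (measurable) functions of time from intervals $]a,b[\subseteq\mathbb{R}$ with $a<0<b$ to $U$; and $f:\mathbb{R}^n\times U\to\mathbb{R}^n$ is continuous and such that for every compact $K\subset\mathbb{R}^n$ there is $\kappa>0$ with $\|f(x,u)-f(y,u)\|\le\kappa\|x-y\|$ for all $x,y\in K$, $u\in U$. A locally absolutely continuous curve $\mathbf{x}:]a,b[\to\mathbb{R}^n$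 is a trajectory of $\Sigma$ if there is $\mathbf{u}\in\mathcal{U}$ with $\dot{\mathbf{x}}(t)=f(\mathbf{x}(t),\mathbf{u}(t))$ for almost all $t\in]a,b[$. $\mathbf{x}(t,x,\mathbf{u})$ denotes the (uniquely determined) point reached at time $t$ under input $\mathbf{u}$ from initial condition $x$ (at time $0$). $\Sigma$ is forward complete if every trajectory is defined on an interval of the form $]a,\infty[$. **$\delta$-GAS.** $\Sigma$ is $\delta$-GAS if it is forward complete and there is a $\mathcal{KL}$ function $\beta$ such that $\|\mathbf{x}(t,x,\mathbf{u})-\mathbf{x}(t,y,\mathbf{u})\|\le\beta(\|x-y\|,t)$ for all $t\ge0$, $x,y\in\mathbb{R}^n$, $\mathbf{u}\in\mathcal{U}$. **Transition systems.** A transition system is a quintuple $T=(Q,L,\longrightarrow,O,H)$: a set of states $Q$, a set of labels $L$, a transition relation $\longrightarrow\subseteq Q\times L\times Q$ (one writes $q\xrightarrow{l}p$ for $(q,l,p)\in\longrightarrow$), an output set $O$ and an output function $H:Q\to O$. It is metric if $O$ is equipped with a metric $\mathbf{d}$. **Approximate bisimulation.** Let $T_i=(Q_i,L_i,\longrightarrow_i,O,H_i)$, $i=1,2$, be metric transition systems with the same output set $O$ and metric $\mathbf{d}$, and let $\varepsilon\ge0$. A relation $R\subseteq Q_1\times Q_2$ is an $\varepsilon$-approximate bisimulation relation between $T_1$ and $T_2$ if for every $(q_1,q_2)\in R$: (i) $\mathbf{d}(H_1(q_1),H_2(q_2))\le\varepsilon$; (ii) $q_1\xrightarrow{l_1}_1p_1$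 implies existence of $q_2\xrightarrow{l_2}_2p_2$ with $(p_1,p_2)\in R$; (iii) $q_2\xrightarrow{l_2}_2p_2$ implies existence of $q_1\xrightarrow{l_1}_1p_1$ with $(p_1,p_2)\in R$. (The labels $l_1,l_2$ need not coincide.) $T_1$ is $\varepsilon$-bisimilar to $T_2$ if there is an $\varepsilon$-approximate bisimulation relation $R$ between them with $R(Q_1)=Q_2$ and $R^{-1}(Q_2)=Q_1$. **The transition system $T_\tau(\Sigma)$.** For $\tau>0$, $T_\tau(\Sigma)=(Q_1,L_1,\longrightarrow_1,O_1,H_1)$ with $Q_1=\mathbb{R}^n$; $L_1=\{l_1\in\mathcal{U} : \mathbf{x}(\tau,x,l_1)\text{ is defined for all }x\in\mathbb{R}^n\}$; $q\xrightarrow{l_1}_1p$ iff $\mathbf{x}(\tau,q,l_1)=p$; $O_1=\mathbb{R}^n$ with metric $\mathbf{d}(p,q)=\|p-q\|$; $H_1$ the identity. **The transition system $T_{\tau,\eta,\mu}(\Sigma)$.** For $q\in\mathbb{R}^n$ let $\mathcal{R}(\tau,q)=\{\mathbf{x}(\tau,q,l_1): l_1\in L_1\}$ and $$\mathcal{P}_\mu(\tau,q)=\{y\in[\mathbb{R}^n]_\mu : \exists z\in\mathcal{R}(\tau,q)\text{ with }\|y-z\|\le\mu/2\}.$$ For each $q\in[\mathbb{R}^n]_\eta$ fix any function $\psi_\mu^{\tau,q}:\mathcal{P}_\mu(\tau,q)\to L_1$ assigning to each $y\in\mathcal{P}_\mu(\tau,q)$ a label $l_1=\psi_\mu^{\tau,q}(y)$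 with $\|y-\mathbf{x}(\tau,q,l_1)\|\le\mu/2$ (such a function exists but is not unique), and set $L_2(q)=\psi_\mu^{\tau,q}(\mathcal{P}_\mu(\tau,q))$. Then $T_{\tau,\eta,\mu}(\Sigma)=(Q_2,L_2,\longrightarrow_2,O_2,H_2)$ with $Q_2=[\mathbb{R}^n]_\eta$; $L_2=\bigcup_{q\in Q_2}L_2(q)$; $q\xrightarrow{l}_2p$ iff $l\in L_2(q)$ and $\|p-\mathbf{x}(\tau,q,l)\|\le\eta/2$; $O_2=\mathbb{R}^n$ with metric $\mathbf{d}(p,q)=\|p-q\|$; $H_2:Q_2\hookrightarrow O_2$ the inclusion map. *)

theory Defs
  imports "HOL-Analysis.Analysis"
begin

text \<open>The norm on \<open>\<real>\<^sup>n\<close> is the infinity norm throughout, i.e. the library's \<^const>\<open>infnorm\<close>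
  (\<open>norm\<close> on \<open>real ^ 'n\<close> is the Euclidean one).\<close>

section \<open>Grids and comparison functions\<close>

definition grid :: "(real ^ 'n) set \<Rightarrow> real \<Rightarrow> (real ^ 'n) set" where
  "grid A \<mu> = {a \<in> A. \<forall>i. \<exists>k::int. a $ i = of_int k * \<mu>}"

text \<open>Comparison functions have domain \<open>[0,\<infinity>)\<close>; values at negative arguments are irrelevant.\<close>

definition class_K :: "(real \<Rightarrow> real) \<Rightarrow> bool" where
  "class_K \<gamma> \<longleftrightarrow>
     \<gamma> \<in> {0..} \<rightarrow> {0..} \<and> continuous_on {0..} \<gamma> \<and> strict_mono_on {0..} \<gamma> \<and> \<gamma> 0 = 0"

definition class_K_inf :: "(real \<Rightarrow> real) \<Rightarrow> bool" where
  "class_K_inf \<gamma> \<longleftrightarrow> class_K \<gamma> \<and> filterlim \<gamma> at_top at_top"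

text \<open>``Decreasing'' has to be non-strict, since \<open>\<beta> 0 s = 0\<close> for every \<open>s\<close>.\<close>

definition class_KL :: "(real \<Rightarrow> real \<Rightarrow> real) \<Rightarrow> bool" where
  "class_KL \<beta> \<longleftrightarrow>
     continuous_on ({0..} \<times> {0..}) (\<lambda>(r, s). \<beta> r s) \<and>
     (\<forall>s\<ge>0. class_K_inf (\<lambda>r. \<beta> r s)) \<and>
     (\<forall>r\<ge>0. antimono_on {0..} (\<beta> r) \<and> (\<beta> r \<longlongrightarrow> 0) at_top)"

section \<open>Control systems\<close>

definition absolutely_continuous_fun_on :: "real \<Rightarrow> real \<Rightarrow> (real \<Rightarrow> real ^ 'n) \<Rightarrow> bool" where
  "absolutely_continuous_fun_on c d g \<longleftrightarrow>
     (\<forall>e>0. \<exists>\<delta>>0. \<forall>D.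
        finite D \<and> (\<forall>(s, t) \<in> D. c \<le> s \<and> s < t \<and> t \<le> d) \<and>
        pairwise (\<lambda>p q. disjnt {fst p<..<snd p} {fst q<..<snd q}) D \<and>
        (\<Sum>(s, t) \<in> D. t - s) < \<delta>
        \<longrightarrow> (\<Sum>(s, t) \<in> D. infnorm (g t - g s)) < e)"

definition locally_absolutely_continuous_on :: "real set \<Rightarrow> (real \<Rightarrow> real ^ 'n) \<Rightarrow> bool" where
  "locally_absolutely_continuous_on I g \<longleftrightarrow>
     (\<forall>c d. c \<le> d \<and> {c..d} \<subseteq> I \<longrightarrow> absolutely_continuous_fun_on c d g)"

text \<open>The intervals \<open>]a,b[\<close> with \<open>a < 0 < b\<close>, where \<open>a = -\<infinity>\<close> and \<open>b = \<infinity>\<close> are allowed.\<close>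

definition time_interval :: "real set \<Rightarrow> bool" where
  "time_interval I \<longleftrightarrow> (\<exists>a b :: ereal. a < 0 \<and> 0 < b \<and> I = einterval a b)"

text \<open>A function of time is defined on its own interval, so it is a partial function;
  its interval is its domain.\<close>

type_synonym 'm input = "real \<Rightarrow> (real ^ 'm) option"

definition admissible_input :: "(real ^ 'm) set \<Rightarrow> 'm input \<Rightarrow> bool" where
  "admissible_input U u \<longleftrightarrow>
     time_interval (dom u) \<and> ran u \<subseteq> U \<and>
     (\<lambda>t. the (u t)) \<in> borel_measurable (lebesgue_on (dom u)) \<and>
     (\<forall>c d. {c..d} \<subseteq> dom u \<longrightarrow>
        (\<exists>M. AE t in lebesgue_on {c..d}. infnorm (the (u t)) \<le> M))"

record ('n::finite, 'm::finite) control_system =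
  input_space :: "(real ^ 'm) set"
  inputs :: "'m input set"
  dynamics :: "real ^ 'n \<Rightarrow> real ^ 'm \<Rightarrow> real ^ 'n"

definition control_system :: "('n::finite, 'm::finite) control_system \<Rightarrow> bool" where
  "control_system S \<longleftrightarrow>
     inputs S \<subseteq> Collect (admissible_input (input_space S)) \<and>
     continuous_on (UNIV \<times> input_space S) (\<lambda>(x, u). dynamics S x u) \<and>
     (\<forall>K. compact K \<longrightarrow>
        (\<exists>\<kappa>>0. \<forall>x\<in>K. \<forall>y\<in>K. \<forall>u\<in>input_space S.
           infnorm (dynamics S x u - dynamics S y u) \<le> \<kappa> * infnorm (x - y)))"

text \<open>\<open>trajectory S u I \<xi>\<close>: the curve \<open>\<xi>\<close>, considered on the interval \<open>I\<close> only, is a trajectory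
  of \<open>S\<close> under the input \<open>u\<close>.\<close>

definition trajectory ::
  "('n::finite, 'm::finite) control_system \<Rightarrow> 'm input \<Rightarrow> real set \<Rightarrow> (real \<Rightarrow> real ^ 'n) \<Rightarrow> bool" where
  "trajectory S u I \<xi> \<longleftrightarrow>
     u \<in> inputs S \<and> time_interval I \<and> I \<subseteq> dom u \<and>
     locally_absolutely_continuous_on I \<xi> \<and>
     (AE t in lebesgue_on I. (\<xi> has_vector_derivative dynamics S (\<xi> t) (the (u t))) (at t))"

definition reaches ::
  "('n::finite, 'm::finite) control_system \<Rightarrow> real \<Rightarrow> real ^ 'n \<Rightarrow> 'm input \<Rightarrow> real ^ 'n \<Rightarrow> bool" where
  "reaches S t x u p \<longleftrightarrow> (\<exists>I \<xi>. trajectory S u I \<xi> \<and> t \<in> I \<and> \<xi> 0 = x \<and> \<xi> t = p)"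

text \<open>The point \<open>\<^bold>x(t,x,\<^bold>u)\<close> need not exist (the trajectory may not extend to time \<open>t\<close>).
  Where it exists it is unique, by the Lipschitz condition on the dynamics. \<open>state_at\<close> is used
  below only together with \<open>state_defined\<close>.\<close>

definition state_defined ::
  "('n::finite, 'm::finite) control_system \<Rightarrow> real \<Rightarrow> real ^ 'n \<Rightarrow> 'm input \<Rightarrow> bool" where
  "state_defined S t x u \<longleftrightarrow> (\<exists>p. reaches S t x u p)"

definition state_at ::
  "('n::finite, 'm::finite) control_system \<Rightarrow> real \<Rightarrow> real ^ 'n \<Rightarrow> 'm input \<Rightarrow> real ^ 'n" where
  "state_at S t x u = (THE p. reaches S t x u p)"

text \<open>Restricting a trajectory to a smaller interval gives a trajectory again, so in the definition
  of forward completeness ``every trajectory'' can only refer to the non-extendable ones.\<close>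

definition maximal_trajectory ::
  "('n::finite, 'm::finite) control_system \<Rightarrow> 'm input \<Rightarrow> real set \<Rightarrow> (real \<Rightarrow> real ^ 'n) \<Rightarrow> bool" where
  "maximal_trajectory S u I \<xi> \<longleftrightarrow>
     trajectory S u I \<xi> \<and>
     \<not> (\<exists>J \<zeta>. trajectory S u J \<zeta> \<and> I \<subset> J \<and> (\<forall>t\<in>I. \<zeta> t = \<xi> t))"

definition forward_complete :: "('n::finite, 'm::finite) control_system \<Rightarrow> bool" where
  "forward_complete S \<longleftrightarrow>
     (\<forall>u I \<xi>. maximal_trajectory S u I \<xi> \<longrightarrow> (\<exists>a::ereal. I = einterval a \<infinity>))"

definition delta_GAS_bound :: "('n::finite, 'm::finite) control_system \<Rightarrow> (real \<Rightarrow> real \<Rightarrow> real) \<Rightarrow> bool" where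
  "delta_GAS_bound S \<beta> \<longleftrightarrow>
     class_KL \<beta> \<and>
     (\<forall>t\<ge>0. \<forall>x y. \<forall>u\<in>inputs S. state_defined S t x u \<and> state_defined S t y u \<longrightarrow>
        infnorm (state_at S t x u - state_at S t y u) \<le> \<beta> (infnorm (x - y)) t)"

definition delta_GAS :: "('n::finite, 'm::finite) control_system \<Rightarrow> bool" where
  "delta_GAS S \<longleftrightarrow> forward_complete S \<and> (\<exists>\<beta>. delta_GAS_bound S \<beta>)"

section \<open>Metric transition systems and approximate bisimulation\<close>

record ('q, 'l, 'o) metric_transition_system =
  states :: "'q set"
  labels :: "'l set"
  transitions :: "('q \<times> 'l \<times> 'q) set"
  outputs :: "'o set"
  out_dist :: "'o \<Rightarrow> 'o \<Rightarrow> real"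
  out_map :: "'q \<Rightarrow> 'o"

definition metric_transition_system :: "('q, 'l, 'o) metric_transition_system \<Rightarrow> bool" where
  "metric_transition_system T \<longleftrightarrow>
     transitions T \<subseteq> states T \<times> labels T \<times> states T \<and>
     out_map T \<in> states T \<rightarrow> outputs T \<and>
     Metric_space (outputs T) (out_dist T)"

definition same_observations ::
  "('q1, 'l1, 'o) metric_transition_system \<Rightarrow> ('q2, 'l2, 'o) metric_transition_system \<Rightarrow> bool" where
  "same_observations T1 T2 \<longleftrightarrow>
     outputs T1 = outputs T2 \<and>
     (\<forall>p\<in>outputs T1. \<forall>q\<in>outputs T1. out_dist T1 p q = out_dist T2 p q)"

definition approx_bisimulation ::
  "real \<Rightarrow> ('q1, 'l1, 'o) metric_transition_system \<Rightarrow> ('q2, 'l2, 'o) metric_transition_system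
     \<Rightarrow> ('q1 \<times> 'q2) set \<Rightarrow> bool" where
  "approx_bisimulation \<epsilon> T1 T2 R \<longleftrightarrow>
     R \<subseteq> states T1 \<times> states T2 \<and>
     (\<forall>(q1, q2) \<in> R.
        out_dist T1 (out_map T1 q1) (out_map T2 q2) \<le> \<epsilon> \<and>
        (\<forall>l1 p1. (q1, l1, p1) \<in> transitions T1 \<longrightarrow>
           (\<exists>l2 p2. (q2, l2, p2) \<in> transitions T2 \<and> (p1, p2) \<in> R)) \<and>
        (\<forall>l2 p2. (q2, l2, p2) \<in> transitions T2 \<longrightarrow>
           (\<exists>l1 p1. (q1, l1, p1) \<in> transitions T1 \<and> (p1, p2) \<in> R)))"

definition approx_bisimilar ::
  "real \<Rightarrow> ('q1, 'l1, 'o) metric_transition_system \<Rightarrow> ('q2, 'l2, 'o) metric_transition_system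
     \<Rightarrow> bool" where
  "approx_bisimilar \<epsilon> T1 T2 \<longleftrightarrow>
     metric_transition_system T1 \<and> metric_transition_system T2 \<and> same_observations T1 T2 \<and>
     0 \<le> \<epsilon> \<and>
     (\<exists>R. approx_bisimulation \<epsilon> T1 T2 R \<and>
        R `` states T1 = states T2 \<and> R\<inverse> `` states T2 = states T1)"

section \<open>The transition systems of a control system\<close>

definition sampled_labels :: "('n::finite, 'm::finite) control_system \<Rightarrow> real \<Rightarrow> 'm input set" where
  "sampled_labels S \<tau> = {l \<in> inputs S. \<forall>x. state_defined S \<tau> x l}"

definition sampled_system ::
  "('n::finite, 'm::finite) control_system \<Rightarrow> real
     \<Rightarrow> (real ^ 'n, 'm input, real ^ 'n) metric_transition_system" where
  "sampled_system S \<tau> =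
     \<lparr>states = UNIV,
      labels = sampled_labels S \<tau>,
      transitions = {(q, l, p). l \<in> sampled_labels S \<tau> \<and> state_at S \<tau> q l = p},
      outputs = UNIV,
      out_dist = (\<lambda>p q. infnorm (p - q)),
      out_map = (\<lambda>q. q)\<rparr>"

definition reachable_set :: "('n::finite, 'm::finite) control_system \<Rightarrow> real \<Rightarrow> real ^ 'n \<Rightarrow> (real ^ 'n) set" where
  "reachable_set S \<tau> q = (\<lambda>l. state_at S \<tau> q l) ` sampled_labels S \<tau>"

definition reachable_grid ::
  "('n::finite, 'm::finite) control_system \<Rightarrow> real \<Rightarrow> real \<Rightarrow> real ^ 'n \<Rightarrow> (real ^ 'n) set" where
  "reachable_grid S \<mu> \<tau> q =
     {y \<in> grid UNIV \<mu>. \<exists>z\<in>reachable_set S \<tau> q. infnorm (y - z) \<le> \<mu> / 2}"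

text \<open>\<open>\<psi> q\<close> is the function \<open>\<psi>\<^sub>\<mu>\<close> with superscript \<open>\<tau>,q\<close>; it matters only for \<open>q\<close> in the state grid
  and on \<open>reachable_grid S \<mu> \<tau> q\<close>.\<close>

definition label_selection ::
  "('n::finite, 'm::finite) control_system \<Rightarrow> real \<Rightarrow> real \<Rightarrow> real
     \<Rightarrow> (real ^ 'n \<Rightarrow> real ^ 'n \<Rightarrow> 'm input) \<Rightarrow> bool" where
  "label_selection S \<tau> \<eta> \<mu> \<psi> \<longleftrightarrow>
     (\<forall>q\<in>grid UNIV \<eta>. \<forall>y\<in>reachable_grid S \<mu> \<tau> q.
        \<psi> q y \<in> sampled_labels S \<tau> \<and> infnorm (y - state_at S \<tau> q (\<psi> q y)) \<le> \<mu> / 2)"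

definition symbolic_labels ::
  "('n::finite, 'm::finite) control_system \<Rightarrow> real \<Rightarrow> real
     \<Rightarrow> (real ^ 'n \<Rightarrow> real ^ 'n \<Rightarrow> 'm input) \<Rightarrow> real ^ 'n \<Rightarrow> 'm input set" where
  "symbolic_labels S \<tau> \<mu> \<psi> q = \<psi> q ` reachable_grid S \<mu> \<tau> q"

definition symbolic_system ::
  "('n::finite, 'm::finite) control_system \<Rightarrow> real \<Rightarrow> real \<Rightarrow> real
     \<Rightarrow> (real ^ 'n \<Rightarrow> real ^ 'n \<Rightarrow> 'm input)
     \<Rightarrow> (real ^ 'n, 'm input, real ^ 'n) metric_transition_system" where
  "symbolic_system S \<tau> \<eta> \<mu> \<psi> =
     \<lparr>states = grid UNIV \<eta>,
      labels = (\<Union>q\<in>grid UNIV \<eta>. symbolic_labels S \<tau> \<mu> \<psi> q),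
      transitions = {(q, l, p). q \<in> grid UNIV \<eta> \<and> p \<in> grid UNIV \<eta> \<and>
        l \<in> symbolic_labels S \<tau> \<mu> \<psi> q \<and> infnorm (p - state_at S \<tau> q l) \<le> \<eta> / 2},
      outputs = UNIV,
      out_dist = (\<lambda>p q. infnorm (p - q)),
      out_map = (\<lambda>q. q)\<rparr>"

end

theory Submission
  imports Defs
begin

text \<open>
  The bisimulation relation is proximity: a point is related to every grid point at distance at most
  \<open>\<epsilon>\<close>. Both kinds of transition are matched by the same triangle inequality. If one applies a single
  input \<open>l\<close> to two related states, incremental stability leaves the two end points at distance at
  most \<open>\<beta> \<epsilon> \<tau>\<close>, because \<open>\<beta>\<close> is increasing in its first argument.

  A symbolic step is a step of the control system followed by rounding to the state grid, at a cost
  of \<open>\<eta> / 2\<close>, so replaying its label from the other state matches it within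
  \<open>\<beta> \<epsilon> \<tau> + \<eta> / 2\<close>. Conversely, a step under an arbitrary input need not be available to the
  symbolic model, which keeps one representative label for each \<open>\<mu>\<close>-grid point near the reachable
  set. Going from the true end point to that grid point, and from there to the end point of the
  representative, costs \<open>\<mu> / 2\<close> each, and rounding again costs \<open>\<eta> / 2\<close>. The total is
  \<open>\<beta> \<epsilon> \<tau> + \<mu> + \<eta> / 2 \<le> \<epsilon>\<close>, which restores the relation.

  The relation covers all states since every point is within \<open>\<eta> / 2 \<le> \<epsilon>\<close> of the state grid.

  All end points compared here belong to inputs whose trajectories reach time \<open>\<tau>\<close> from every
  initial state, which is why the stability estimate applies to them.
\<close>

section \<open>The infinity norm and grids\<close>

lemma infnorm_le_componentwise:
  fixes x :: "real ^ 'n"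
  assumes "\<And>i. \<bar>x $ i\<bar> \<le> c"
  shows "infnorm x \<le> c"
  unfolding infnorm_cart using assms by (intro cSup_least) auto

lemma infnorm_triangle_via:
  fixes a b c :: "'a::euclidean_space"
  assumes "infnorm (a - b) \<le> d" and "infnorm (b - c) \<le> e"
  shows "infnorm (a - c) \<le> d + e"
  using infnorm_triangle[of "a - b" "b - c"] assms by simp

lemma Metric_space_infnorm:
  "Metric_space UNIV (\<lambda>p q :: 'a::euclidean_space. infnorm (p - q))"
proof
  fix x y z :: 'a
  show "0 \<le> infnorm (x - y)" by (rule infnorm_pos_le)
  show "infnorm (x - y) = infnorm (y - x)" by (rule infnorm_sub)
  show "infnorm (x - y) = 0 \<longleftrightarrow> x = y" by (simp add: infnorm_eq_0)
  show "infnorm (x - z) \<le> infnorm (x - y) + infnorm (y - z)"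
    by (rule infnorm_triangle_via[OF order_refl order_refl])
qed

text \<open>Rounding each coordinate to the nearest multiple of \<open>\<mu>\<close> is possible independently of the
  others, so in the infinity norm the error stays \<open>\<mu> / 2\<close> in every dimension.\<close>

lemma grid_point_within_half_step:
  fixes x :: "real ^ 'n"
  assumes "\<mu> > 0"
  obtains y where "y \<in> grid UNIV \<mu>" and "infnorm (y - x) \<le> \<mu> / 2"
proof
  define y :: "real ^ 'n" where "y = (\<chi> i. of_int (round (x $ i / \<mu>)) * \<mu>)"
  show "y \<in> grid UNIV \<mu>"
    unfolding grid_def y_def by auto
  show "infnorm (y - x) \<le> \<mu> / 2"
  proof (rule infnorm_le_componentwise)
    fix i
    have "(y - x) $ i = (of_int (round (x $ i / \<mu>)) - x $ i / \<mu>) * \<mu>"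
      using assms by (simp add: y_def field_simps)
    then have "\<bar>(y - x) $ i\<bar> = \<bar>of_int (round (x $ i / \<mu>)) - x $ i / \<mu>\<bar> * \<mu>"
      using assms by (simp add: abs_mult)
    also have "\<dots> \<le> 1 / 2 * \<mu>"
      using assms of_int_round_abs_le[of "x $ i / \<mu>"] by (intro mult_right_mono) auto
    finally show "\<bar>(y - x) $ i\<bar> \<le> \<mu> / 2" by simp
  qed
qed

section \<open>Incremental stability of sampled steps\<close>

lemma class_KL_mono:
  assumes "class_KL \<beta>" "0 \<le> r" "r \<le> r'" "0 \<le> s"
  shows "\<beta> r s \<le> \<beta> r' s"
proof -
  have "strict_mono_on {0..} (\<lambda>r. \<beta> r s)"
    using assms unfolding class_KL_def class_K_inf_def class_K_def by blast
  from strict_mono_on_leD[OF this] show ?thesis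
    using assms by auto
qed

lemma class_KL_nonneg:
  assumes "class_KL \<beta>" "0 \<le> r" "0 \<le> s"
  shows "0 \<le> \<beta> r s"
  using assms unfolding class_KL_def class_K_inf_def class_K_def by (auto simp: Pi_iff)

lemma sampled_step_dist_le:
  assumes bound: "delta_GAS_bound S \<beta>" and "0 \<le> \<tau>"
    and l: "l \<in> sampled_labels S \<tau>" and close: "infnorm (x - y) \<le> \<epsilon>"
  shows "infnorm (state_at S \<tau> x l - state_at S \<tau> y l) \<le> \<beta> \<epsilon> \<tau>"
proof -
  have "infnorm (state_at S \<tau> x l - state_at S \<tau> y l) \<le> \<beta> (infnorm (x - y)) \<tau>"
    using bound l \<open>0 \<le> \<tau>\<close> unfolding delta_GAS_bound_def sampled_labels_def by blast
  also have "\<dots> \<le> \<beta> \<epsilon> \<tau>"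
    using class_KL_mono[of \<beta> "infnorm (x - y)" \<epsilon> \<tau>] bound \<open>0 \<le> \<tau>\<close> close
    unfolding delta_GAS_bound_def by (simp add: infnorm_pos_le)
  finally show ?thesis .
qed

section \<open>The symbolic labels\<close>

lemma symbolic_labels_subset_sampled_labels:
  assumes "label_selection S \<tau> \<eta> \<mu> \<psi>" "q \<in> grid UNIV \<eta>"
  shows "symbolic_labels S \<tau> \<mu> \<psi> q \<subseteq> sampled_labels S \<tau>"
  using assms unfolding label_selection_def symbolic_labels_def by blast

text \<open>The selection quantizes inputs by their effect: the end point under \<open>l\<close> is within \<open>\<mu> / 2\<close> of
  some grid point, and the label selected for that grid point ends within \<open>\<mu> / 2\<close> of it too.\<close>

lemma symbolic_label_approximates:
  assumes sel: "label_selection S \<tau> \<eta> \<mu> \<psi>" and q: "q \<in> grid UNIV \<eta>" and "\<mu> > 0"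
    and l: "l \<in> sampled_labels S \<tau>"
  obtains l' where "l' \<in> symbolic_labels S \<tau> \<mu> \<psi> q"
    and "infnorm (state_at S \<tau> q l - state_at S \<tau> q l') \<le> \<mu>"
proof -
  obtain y where y: "y \<in> grid UNIV \<mu>" "infnorm (y - state_at S \<tau> q l) \<le> \<mu> / 2"
    using grid_point_within_half_step[OF \<open>\<mu> > 0\<close>] .
  then have reach: "y \<in> reachable_grid S \<mu> \<tau> q"
    using l unfolding reachable_grid_def reachable_set_def by blast
  then have "infnorm (y - state_at S \<tau> q (\<psi> q y)) \<le> \<mu> / 2"
    using sel q unfolding label_selection_def by blast
  with y(2) have "infnorm (state_at S \<tau> q l - state_at S \<tau> q (\<psi> q y)) \<le> \<mu> / 2 + \<mu> / 2"
    by (intro infnorm_triangle_via[of _ y]) (simp_all add: infnorm_sub)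
  moreover have "\<psi> q y \<in> symbolic_labels S \<tau> \<mu> \<psi> q"
    using reach unfolding symbolic_labels_def by blast
  ultimately show thesis using that by simp
qed

section \<open>The two transition systems\<close>

lemma metric_transition_system_sampled: "metric_transition_system (sampled_system S \<tau>)"
  unfolding metric_transition_system_def sampled_system_def
  using Metric_space_infnorm by auto

lemma metric_transition_system_symbolic:
  "metric_transition_system (symbolic_system S \<tau> \<eta> \<mu> \<psi>)"
  unfolding metric_transition_system_def symbolic_system_def
  using Metric_space_infnorm by auto

lemma approx_bisimulation_proximity:
  fixes S :: "('n::finite, 'm::finite) control_system"
  assumes bound: "delta_GAS_bound S \<beta>"
    and pos: "\<tau> > 0" "\<eta> > 0" "\<mu> > 0"
    and prec: "\<beta> \<epsilon> \<tau> + \<mu> + \<eta> / 2 \<le> \<epsilon>"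
    and sel: "label_selection S \<tau> \<eta> \<mu> \<psi>"
  shows "approx_bisimulation \<epsilon> (sampled_system S \<tau>) (symbolic_system S \<tau> \<eta> \<mu> \<psi>)
           {(x, q). q \<in> grid UNIV \<eta> \<and> infnorm (x - q) \<le> \<epsilon>}"
proof -
  have match_sampled: "\<exists>l' p. l' \<in> symbolic_labels S \<tau> \<mu> \<psi> q \<and> p \<in> grid UNIV \<eta> \<and>
      infnorm (p - state_at S \<tau> q l') \<le> \<eta> / 2 \<and> infnorm (state_at S \<tau> x l - p) \<le> \<epsilon>"
    if q: "q \<in> grid UNIV \<eta>" and close: "infnorm (x - q) \<le> \<epsilon>" and l: "l \<in> sampled_labels S \<tau>"
    for x q l
  proof -
    obtain l' where l': "l' \<in> symbolic_labels S \<tau> \<mu> \<psi> q"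
      "infnorm (state_at S \<tau> q l - state_at S \<tau> q l') \<le> \<mu>"
      using symbolic_label_approximates[OF sel q \<open>\<mu> > 0\<close> l] .
    obtain p where p: "p \<in> grid UNIV \<eta>" "infnorm (p - state_at S \<tau> q l') \<le> \<eta> / 2"
      using grid_point_within_half_step[OF \<open>\<eta> > 0\<close>] .
    have "infnorm (state_at S \<tau> x l - state_at S \<tau> q l) \<le> \<beta> \<epsilon> \<tau>"
      using sampled_step_dist_le[OF bound _ l close] \<open>\<tau> > 0\<close> by simp
    from infnorm_triangle_via[OF infnorm_triangle_via[OF this l'(2)], of p "\<eta> / 2"] p(2)
    have "infnorm (state_at S \<tau> x l - p) \<le> \<beta> \<epsilon> \<tau> + \<mu> + \<eta> / 2"
      by (simp add: infnorm_sub)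
    with prec have "infnorm (state_at S \<tau> x l - p) \<le> \<epsilon>" by linarith
    with l'(1) p show ?thesis by blast
  qed
  have match_symbolic: "l \<in> sampled_labels S \<tau> \<and> infnorm (state_at S \<tau> x l - p) \<le> \<epsilon>"
    if q: "q \<in> grid UNIV \<eta>" and close: "infnorm (x - q) \<le> \<epsilon>"
      and l: "l \<in> symbolic_labels S \<tau> \<mu> \<psi> q" and p: "infnorm (p - state_at S \<tau> q l) \<le> \<eta> / 2"
    for x q l p
  proof -
    have l_sampled: "l \<in> sampled_labels S \<tau>"
      using symbolic_labels_subset_sampled_labels[OF sel q] l by blast
    have "infnorm (state_at S \<tau> x l - state_at S \<tau> q l) \<le> \<beta> \<epsilon> \<tau>"
      using sampled_step_dist_le[OF bound _ l_sampled close] \<open>\<tau> > 0\<close> by simp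
    from infnorm_triangle_via[OF this, of p "\<eta> / 2"] p
    have "infnorm (state_at S \<tau> x l - p) \<le> \<beta> \<epsilon> \<tau> + \<eta> / 2"
      by (simp add: infnorm_sub)
    with l_sampled prec \<open>\<mu> > 0\<close> show ?thesis by simp
  qed
  let ?T1 = "sampled_system S \<tau>" and ?T2 = "symbolic_system S \<tau> \<eta> \<mu> \<psi>"
  let ?R = "{(x, q). q \<in> grid UNIV \<eta> \<and> infnorm (x - q) \<le> \<epsilon>}"
  have "out_dist ?T1 (out_map ?T1 x) (out_map ?T2 q) \<le> \<epsilon> \<and>
      (\<forall>l p. (x, l, p) \<in> transitions ?T1 \<longrightarrow>
         (\<exists>l' p'. (q, l', p') \<in> transitions ?T2 \<and> (p, p') \<in> ?R)) \<and>
      (\<forall>l' p'. (q, l', p') \<in> transitions ?T2 \<longrightarrow>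
         (\<exists>l p. (x, l, p) \<in> transitions ?T1 \<and> (p, p') \<in> ?R))"
    if q: "q \<in> grid UNIV \<eta>" and close: "infnorm (x - q) \<le> \<epsilon>" for x q
  proof (intro conjI allI impI)
    show "out_dist ?T1 (out_map ?T1 x) (out_map ?T2 q) \<le> \<epsilon>"
      using close by (simp add: sampled_system_def symbolic_system_def)
  next
    fix l p assume "(x, l, p) \<in> transitions ?T1"
    then have l: "l \<in> sampled_labels S \<tau>" and p: "p = state_at S \<tau> x l"
      by (simp_all add: sampled_system_def)
    show "\<exists>l' p'. (q, l', p') \<in> transitions ?T2 \<and> (p, p') \<in> ?R"
      using match_sampled[OF q close l] q by (simp add: symbolic_system_def p) blast
  next
    fix l' p' assume "(q, l', p') \<in> transitions ?T2"
    then have l': "l' \<in> symbolic_labels S \<tau> \<mu> \<psi> q" and p': "p' \<in> grid UNIV \<eta>"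
      and near: "infnorm (p' - state_at S \<tau> q l') \<le> \<eta> / 2"
      by (simp_all add: symbolic_system_def)
    show "\<exists>l p. (x, l, p) \<in> transitions ?T1 \<and> (p, p') \<in> ?R"
      using match_symbolic[OF q close l' near] p' by (auto simp: sampled_system_def)
  qed
  moreover have "?R \<subseteq> states ?T1 \<times> states ?T2"
    by (auto simp: sampled_system_def symbolic_system_def)
  ultimately show ?thesis
    unfolding approx_bisimulation_def by blast
qed

theorem theorem4p1:
  fixes S :: "('n::finite, 'm::finite) control_system"
    and \<beta> :: "real \<Rightarrow> real \<Rightarrow> real"
    and \<epsilon> \<tau> \<eta> \<mu> :: real
    and \<psi> :: "real ^ 'n \<Rightarrow> real ^ 'n \<Rightarrow> 'm input"
  assumes "control_system S"
    and "\<epsilon> > 0"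
    and "delta_GAS S"
    and "delta_GAS_bound S \<beta>"
    and "\<tau> > 0" and "\<eta> > 0" and "\<mu> > 0"
    and "\<beta> \<epsilon> \<tau> + \<mu> + \<eta> / 2 \<le> \<epsilon>"
    and "label_selection S \<tau> \<eta> \<mu> \<psi>"
  shows "approx_bisimilar \<epsilon> (sampled_system S \<tau>) (symbolic_system S \<tau> \<eta> \<mu> \<psi>)"
proof -
  let ?T1 = "sampled_system S \<tau>" and ?T2 = "symbolic_system S \<tau> \<eta> \<mu> \<psi>"
  let ?R = "{(x :: real ^ 'n, q). q \<in> grid UNIV \<eta> \<and> infnorm (x - q) \<le> \<epsilon>}"
  have bisim: "approx_bisimulation \<epsilon> ?T1 ?T2 ?R"
    by (rule approx_bisimulation_proximity[OF assms(4-9)])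
  have "0 \<le> \<beta> \<epsilon> \<tau>"
    using assms unfolding delta_GAS_bound_def by (simp add: class_KL_nonneg)
  with assms have half_step: "\<eta> / 2 \<le> \<epsilon>" by linarith
  have "\<exists>q. q \<in> grid UNIV \<eta> \<and> infnorm (x - q) \<le> \<epsilon>" for x :: "real ^ 'n"
    using grid_point_within_half_step[OF \<open>\<eta> > 0\<close>, of x] half_step
    by (metis infnorm_sub order_trans)
  then have "?R\<inverse> `` states ?T2 = states ?T1"
    by (auto simp: sampled_system_def symbolic_system_def)
  moreover
  have "(q, q) \<in> ?R" if "q \<in> grid UNIV \<eta>" for q
    using that \<open>\<epsilon> > 0\<close> by (simp add: infnorm_0)
  then have "?R `` states ?T1 = states ?T2"
    unfolding sampled_system_def symbolic_system_def by (simp, blast)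
  moreover have "same_observations ?T1 ?T2"
    by (simp add: same_observations_def sampled_system_def symbolic_system_def)
  ultimately show ?thesis
    unfolding approx_bisimilar_def
    using bisim \<open>\<epsilon> > 0\<close> metric_transition_system_sampled metric_transition_system_symbolic
    by (intro conjI exI[of _ ?R]) simp_all
qed

end
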